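(* Let $G$ be a simple graph with $n \geq 5$ vertices and $m$ edges, with degree sequence $\Delta = d_1 \geq d_2 \geq \cdots \geq d_n = \delta > 0$. Then for any $\alpha \in \mathbb{R}$ and any pairwise distinct indices $j, k, l, p \in \{1, \dots, n\}$, \[ Z_{2\alpha}(G) \geq d_l^{2\alpha} + d_p^{2\alpha} + \frac{\left(Z_\alpha(G) - d_l^\alpha - d_p^\alpha\right)^2}{n-2} + \frac{1}{2}\left(d_j^\alpha - d_k^\alpha\right)^2 + \frac{2(n-2)}{n-4}\left(\frac{Z_\alpha(G) - d_l^\alpha - d_p^\alpha}{n-2} - \frac{d_j^\alpha + d_k^\alpha}{2}\right)^2. \]
   Context: For a graph $G$ with vertex degrees $d_1,\dots,d_n$ and $\beta \in \mathbb{R}$, the first general Zagreb index is $Z_\beta(G) = \sum_{i=1}^n d_i^\beta$. *)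

theory Defs
  imports Complex_Main "Graph_Theory.Digraph"
begin

text \<open>
  A simple graph is a loop-free symmetric digraph without multiple arcs (locale \<^const>\<open>graph\<close>),
  so each undirected edge \<open>{u, v}\<close> is a pair of opposite arcs. Hence the number of arcs leaving
  a vertex is its degree in the undirected sense, and the edges are the unordered pairs of
  adjacent vertices.
\<close>

definition degree :: "('a, 'b) pre_digraph \<Rightarrow> 'a \<Rightarrow> nat" where
  "degree G v = out_degree G v"

definition edges :: "('a, 'b) pre_digraph \<Rightarrow> 'a set set" where
  "edges G = {{u, v} | u v. u \<rightarrow>\<^bsub>G\<^esub> v}"

text \<open>The entries of the sequence \<open>d\<close> are \<open>d 1, \<dots>, d n\<close>; its other values are irrelevant.\<close>

definition degree_sequence :: "('a, 'b) pre_digraph \<Rightarrow> nat \<Rightarrow> (nat \<Rightarrow> nat) \<Rightarrow> bool" where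
  "degree_sequence G n d \<longleftrightarrow>
    (\<exists>v. bij_betw v {1..n} (verts G) \<and> (\<forall>i\<in>{1..n}. d i = degree G (v i))) \<and>
    (\<forall>i\<in>{1..n}. \<forall>j\<in>{1..n}. i \<le> j \<longrightarrow> d j \<le> d i)"

text \<open>
  Meant for graphs without isolated vertices: since \<open>0 powr \<beta> = 0\<close> for every \<open>\<beta>\<close>, isolated
  vertices would contribute nothing.
\<close>

definition zagreb :: "real \<Rightarrow> ('a, 'b) pre_digraph \<Rightarrow> real" where
  "zagreb \<beta> G = (\<Sum>v\<in>verts G. real (degree G v) powr \<beta>)"

end

theory Submission
  imports Defs "HOL-Analysis.Convex"
begin

text \<open>
  Apart from the terms of the indices \<open>l\<close>, \<open>p\<close>, \<open>j\<close> and \<open>k\<close>, the sum \<open>Z\<^sub>2\<^sub>\<alpha>\<close> has \<open>n - 4\<close> terms, to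
  which the Cauchy--Schwarz inequality applies. The right-hand side of the theorem is
  the resulting bound, rewritten by the decomposition of a sum of squares about the mean
  of the \<open>n - 2\<close> terms other than \<open>l\<close> and \<open>p\<close>.
\<close>

text \<open>Here \<open>S\<close> stands for the sum of \<open>N\<close> numbers, \<open>a\<close>
  and \<open>b\<close> among them. Put u = (a + b)/2 and w = (S - a - b)/(N - 2). Then a^2 + b^2 =
  (a - b)^2/2 + 2u^2, and 2u^2 + (N - 2)w^2 = S^2/N + 2(N - 2)/N * (u - w)^2. Since S/N - u = (N -
  2)/N * (w - u), the last term is the one with factor 2N/(N - 2).\<close>

lemma sum_squares_about_mean:
  fixes a b S N :: real
  assumes "N > 2"
  shows "S\<^sup>2 / N + (a - b)\<^sup>2 / 2 + 2 * N / (N - 2) * (S / N - (a + b) / 2)\<^sup>2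
    = a\<^sup>2 + b\<^sup>2 + (S - a - b)\<^sup>2 / (N - 2)"
proof -
  have N: "N \<noteq> 0" "N - 2 \<noteq> 0"
    using assms by auto
  show ?thesis
    using N by (simp add: divide_simps) (simp add: algebra_simps power2_eq_square)
qed

lemma sum_squares_ge_two_terms:
  fixes x :: "'i \<Rightarrow> real"
  assumes "finite A" "j \<in> A" "k \<in> A" "j \<noteq> k" "card A > 2"
  shows "(\<Sum>i\<in>A. (x i)\<^sup>2) \<ge> (sum x A)\<^sup>2 / card A + (x j - x k)\<^sup>2 / 2
    + 2 * real (card A) / (real (card A) - 2) * (sum x A / card A - (x j + x k) / 2)\<^sup>2"
proof -
  define B where "B = A - {j, k}"
  have split: "sum f A = f j + f k + sum f B" for f :: "'i \<Rightarrow> real"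
    using assms by (simp add: B_def sum_diff)
  have card: "real (card B) = real (card A) - 2"
    using assms by (simp add: B_def card_Diff_subset)
  \<comment> \<open>Cauchy-Schwarz against the constant 1: the only inequality in the
    argument.\<close>
  have "(sum x B)\<^sup>2 \<le> (\<Sum>i\<in>B. (x i)\<^sup>2) * card B"
    by (rule sum_squared_le_sum_of_squares)
  then have "(sum x B)\<^sup>2 / (real (card A) - 2) \<le> (\<Sum>i\<in>B. (x i)\<^sup>2)"
    using assms card by (simp add: divide_le_eq)
  moreover have "sum x B = sum x A - x j - x k"
    using split[of x] by simp
  ultimately show ?thesis
    using assms sum_squares_about_mean[of "card A" "sum x A" "x j" "x k"]
      split[of "\<lambda>i. (x i)\<^sup>2"] by simp
qed

text \<open>Passing from vertices to indices allows single terms \<open>d l\<close>,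
  \<open>d p\<close> to be split off.\<close>

lemma zagreb_degree_sequence:
  assumes "degree_sequence G n d"
  shows "zagreb \<beta> G = (\<Sum>i=1..n. real (d i) powr \<beta>)"
proof -
  obtain v where bij: "bij_betw v {1..n} (verts G)" and d: "\<forall>i\<in>{1..n}. d i = degree G (v i)"
    using assms unfolding degree_sequence_def by blast
  have "zagreb \<beta> G = (\<Sum>i=1..n. real (degree G (v i)) powr \<beta>)"
    unfolding zagreb_def by (rule sum.reindex_bij_betw[OF bij, symmetric])
  also have "\<dots> = (\<Sum>i=1..n. real (d i) powr \<beta>)"
    using d by (intro sum.cong) auto
  finally show ?thesis .
qed

theorem theorem3:
  fixes G :: "('a, 'b) pre_digraph"
    and n m \<Delta> \<delta> :: nat
    and d :: "nat \<Rightarrow> nat"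
    and \<alpha> :: real
    and j k l p :: nat
  assumes "graph G"
    and "card (verts G) = n"
    and "n \<ge> 5"
    and "card (edges G) = m"
    and "degree_sequence G n d"
    and "\<Delta> = d 1"
    and "d n = \<delta>"
    and "\<delta> > 0"
    and "{j, k, l, p} \<subseteq> {1..n}"
    and "distinct [j, k, l, p]"
  shows "zagreb (2 * \<alpha>) G \<ge>
      real (d l) powr (2 * \<alpha>) + real (d p) powr (2 * \<alpha>)
    + (zagreb \<alpha> G - real (d l) powr \<alpha> - real (d p) powr \<alpha>)\<^sup>2 / (real n - 2)
    + 1 / 2 * (real (d j) powr \<alpha> - real (d k) powr \<alpha>)\<^sup>2
    + 2 * (real n - 2) / (real n - 4) *
        ((zagreb \<alpha> G - real (d l) powr \<alpha> - real (d p) powr \<alpha>) / (real n - 2)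
          - (real (d j) powr \<alpha> + real (d k) powr \<alpha>) / 2)\<^sup>2"
proof -
  define x where "x i = real (d i) powr \<alpha>" for i
  \<comment> \<open>The terms of \<open>l\<close> and \<open>p\<close> are kept exactly; only the
    sum over \<open>A\<close> is estimated.\<close>
  define A where "A = {1..n} - {l, p}"
  have sq: "real (d i) powr (2 * \<alpha>) = (x i)\<^sup>2" for i
    by (simp add: x_def power2_eq_square flip: powr_add)
  have split: "sum f {1..n} = f l + f p + sum f A" for f :: "nat \<Rightarrow> real"
    using assms(9,10) by (simp add: A_def sum_diff)
  have card: "card A = n - 2"
    using assms(9,10) by (simp add: A_def card_Diff_subset)
  then have N: "real (card A) = real n - 2"
    using \<open>n \<ge> 5\<close> by simp
  have Z1: "zagreb \<alpha> G - x l - x p = sum x A"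
    using split[of x] by (simp add: zagreb_degree_sequence[OF assms(5)] flip: x_def)
  have Z2: "zagreb (2 * \<alpha>) G = (x l)\<^sup>2 + (x p)\<^sup>2 + (\<Sum>i\<in>A. (x i)\<^sup>2)"
    using split[of "\<lambda>i. (x i)\<^sup>2"] by (simp add: zagreb_degree_sequence[OF assms(5)] sq)
  \<comment> \<open>From n \<ge> 5, \<open>A\<close> has at least 3 elements, so the denominator n -
    4 = (n - 2) - 2 is positive.\<close>
  have "finite A" "j \<in> A" "k \<in> A" "j \<noteq> k" "card A > 2"
    using assms(3,9,10) card by (auto simp: A_def)
  from sum_squares_ge_two_terms[OF this, of x] show ?thesis
    unfolding sq Z2 x_def[symmetric] Z1 N by simp
qed

end
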